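(* For $\tau\in\mathbb{H}^2$ let $q=e^{2\pi i\tau}$ and $$W=\left\{\frac{\eta(2\tau)\eta^2(3\tau)}{\eta^2(\tau)\eta(6\tau)}\right\}^4=\left\{\frac{(q^2;q^2)_\infty(q^3;q^3)_\infty^2}{(q;q)_\infty^2(q^6;q^6)_\infty}\right\}^4.$$ Then $$q\frac{dW}{dq}=\frac{(q^2;q^2)_\infty^7(q^3;q^3)_\infty^7}{(q;q)_\infty^5(q^6;q^6)_\infty^5}\,(W-1),\qquad\text{equivalently}\qquad \frac{dW}{d\tau}=2\pi i\,\frac{\eta^7(2\tau)\eta^7(3\tau)}{\eta^5(\tau)\eta^5(6\tau)}\,(W-1).$$
   Context: $\mathbb{H}^2$ is the upper half-plane; $q=\exp(2\pi i\tau)$; $(q^k;q^k)_\infty=\prod_{n\ge1}(1-q^{kn})$; the Dedekind eta function is $\eta(\tau)=q^{1/24}(q;q)_\infty$. The derivative $q\,d/dq$ is understood as $\frac{1}{2\pi i}\frac{d}{d\tau}$. *)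

theory Defs
  imports "HOL-Analysis.Analysis"
begin

definition nome :: "complex \<Rightarrow> complex" where
  "nome \<tau> = exp (2 * of_real pi * \<i> * \<tau>)"

definition qpoch :: "nat \<Rightarrow> complex \<Rightarrow> complex" where
  "qpoch k \<tau> = (\<Prod>n. 1 - nome \<tau> ^ (k * Suc n))"

definition W :: "complex \<Rightarrow> complex" where
  "W \<tau> = ((qpoch 2 \<tau> * qpoch 3 \<tau> ^ 2) / (qpoch 1 \<tau> ^ 2 * qpoch 6 \<tau>)) ^ 4"

end

(* Write L_k = sum_m m q^(km) / (1 - q^(km)), so that q d/dq log (q^k;q^k) = - k L_k.
   The log-derivative of W is 8 (L_1 - L_2 - 3 L_3 + 3 L_6).  This Lambert series, as well as
   W - 1, is evaluated by one identity of elliptic functions on C^* / p^Z: the difference of two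
   values of the Weierstrass P-function is a quotient of theta values,
     ell(a) - ell(b) = - b (p;p)^4 theta(ab) theta(a/b) / (theta(a)^2 theta(b)^2).
   As functions of a, both sides have the same double pole at 1 and are invariant under a -> p a
   and a -> 1/a; their difference is therefore constant by the maximum modulus principle on an
   annulus, and it vanishes at a = b.
   With p = q^6, a = q, b = q^3 the left-hand side is L_1 - L_2 - 3 L_3 + 3 L_6.
   With p = q^3 the three differences between the points q, -q, -1 add up to zero, and this
   three-term relation is W = 1 + 8 q (q^2;q^2) (q^6;q^6)^5 / ((q;q)^5 (q^3;q^3)). *)
theory Submission
  imports Defs "HOL-Complex_Analysis.Conformal_Mappings"
begin

section \<open>Infinite products (w; q)_inf and their logarithmic derivatives\<close>

text \<open>The M-test only yields some uniform limit; absolute convergence at each point identifies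
  that limit with the infinite product.\<close>

lemma uniform_limit_prodinf_M_test:
  fixes f :: "nat \<Rightarrow> complex \<Rightarrow> complex"
  assumes cont: "\<And>n. continuous_on K (f n)" and K: "compact K"
    and bound: "\<And>n x. x \<in> K \<Longrightarrow> norm (f n x - 1) \<le> M n" and M: "summable M"
  shows "uniform_limit K (\<lambda>N x. \<Prod>n<N. f n x) (\<lambda>x. \<Prod>n. f n x) sequentially"
proof -
  have "uniformly_convergent_on K (\<lambda>N x. \<Sum>n<N. norm (f n x - 1))"
    by (rule Weierstrass_m_test'[OF _ M]) (simp add: bound)
  then have "uniformly_convergent_on K (\<lambda>N x. \<Prod>n<N. f n x)"
    using cont K by (intro uniformly_convergent_on_prod') auto
  then obtain g where g: "uniform_limit K (\<lambda>N x. \<Prod>n<N. f n x) g sequentially"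
    by (auto simp: uniformly_convergent_on_def)
  have "g x = (\<Prod>n. f n x)" if "x \<in> K" for x
  proof -
    have "summable (\<lambda>n. norm (f n x - 1))"
      by (rule summable_comparison_test'[OF M]) (simp add: bound that)
    then have "convergent_prod (\<lambda>n. f n x)"
      using abs_convergent_prod_conv_summable abs_convergent_prod_imp_convergent_prod by blast
    then have "(\<lambda>N. \<Prod>n<N. f n x) \<longlonglongrightarrow> (\<Prod>n. f n x)"
      using convergent_prod_LIMSEQ LIMSEQ_lessThan_iff_atMost by blast
    moreover have "(\<lambda>N. \<Prod>n<N. f n x) \<longlonglongrightarrow> g x"
      using g that by (rule tendsto_uniform_limitI)
    ultimately show ?thesis by (rule LIMSEQ_unique[symmetric])
  qed
  then show ?thesis
    using g by (simp cong: uniform_limit_cong')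
qed

text \<open>The q-Pochhammer symbol (w; q)_inf. Base and argument are separate because theta
  functions need general arguments; the Euler products of the theorem are the diagonal values
  \<open>qp q q\<close>.\<close>

definition qp :: "complex \<Rightarrow> complex \<Rightarrow> complex" where
  "qp q w = (\<Prod>n. 1 - w * q ^ n)"

lemma summable_qp:
  assumes "norm q < 1"
  shows "summable (\<lambda>n. R * norm (q :: complex) ^ n)"
  using assms by (intro summable_mult summable_geometric) auto

lemma convergent_prod_qp:
  assumes "norm q < 1"
  shows "convergent_prod (\<lambda>n. 1 - w * q ^ n :: complex)"
proof -
  have "summable (\<lambda>n. norm (1 - w * q ^ n - 1))"
    using summable_qp[OF assms, of "norm w"] by (simp add: norm_mult norm_power)
  then show ?thesis
    using abs_convergent_prod_conv_summable abs_convergent_prod_imp_convergent_prod by blast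
qed

lemma qp_tendsto:
  assumes "norm q < 1"
  shows "(\<lambda>N. \<Prod>n<N. 1 - w * q ^ n) \<longlonglongrightarrow> qp q w"
  unfolding qp_def using convergent_prod_LIMSEQ[OF convergent_prod_qp[OF assms]]
    LIMSEQ_lessThan_iff_atMost by blast

lemma qp_nonzero:
  assumes "norm q < 1" "norm w < 1"
  shows "qp q w \<noteq> 0"
  unfolding qp_def
proof (rule prodinf_nonzero[OF convergent_prod_qp[OF assms(1)]])
  fix n
  have "norm (w * q ^ n) \<le> norm w * 1"
    unfolding norm_mult norm_power using assms by (intro mult_left_mono power_le_one) auto
  with assms have "norm (w * q ^ n) < 1" by linarith
  then show "1 - w * q ^ n \<noteq> 0" by auto
qed

lemma qp_rec:
  assumes "norm q < 1"
  shows "qp q w = (1 - w) * qp q (q * w)"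
proof (rule LIMSEQ_unique)
  show "(\<lambda>N. \<Prod>n<Suc N. 1 - w * q ^ n) \<longlonglongrightarrow> qp q w"
    by (rule LIMSEQ_Suc[OF qp_tendsto[OF assms]])
  show "(\<lambda>N. \<Prod>n<Suc N. 1 - w * q ^ n) \<longlonglongrightarrow> (1 - w) * qp q (q * w)"
    unfolding prod.lessThan_Suc_shift
    using tendsto_mult[OF tendsto_const[of "1 - w"] qp_tendsto[OF assms, of "q * w"]]
    by (simp add: mult_ac)
qed

text \<open>Factor by factor, (1 - w q^n)(1 + w q^n) = 1 - w^2 q^(2n).\<close>

lemma qp_mult_minus:
  assumes "norm q < 1"
  shows "qp q w * qp q (- w) = qp (q\<^sup>2) (w\<^sup>2)"
proof (rule LIMSEQ_unique)
  show "(\<lambda>N. (\<Prod>n<N. 1 - w * q ^ n) * (\<Prod>n<N. 1 - (- w) * q ^ n)) \<longlonglongrightarrow> qp q w * qp q (- w)"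
    by (intro tendsto_mult qp_tendsto assms)
  have "(\<Prod>n<N. 1 - w * q ^ n) * (\<Prod>n<N. 1 - (- w) * q ^ n) = (\<Prod>n<N. 1 - w\<^sup>2 * (q\<^sup>2) ^ n)" for N
    unfolding prod.distrib[symmetric]
    by (intro prod.cong refl)
       (simp add: algebra_simps power2_eq_square power_mult_distrib)
  moreover have "norm (q\<^sup>2) < 1" using assms by (simp add: norm_power power_less_one_iff)
  ultimately show "(\<lambda>N. (\<Prod>n<N. 1 - w * q ^ n) * (\<Prod>n<N. 1 - (- w) * q ^ n)) \<longlonglongrightarrow> qp (q\<^sup>2) (w\<^sup>2)"
    using qp_tendsto by presburger
qed

text \<open>The exponents are sorted by their residue modulo \<open>m\<close>.\<close>

lemma qp_split:
  assumes "norm q < 1" "m > 0"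
  shows "qp q w = (\<Prod>j<m. qp (q ^ m) (w * q ^ j))"
proof (rule LIMSEQ_unique)
  have "filterlim (\<lambda>N. N * m) sequentially sequentially"
    using assms(2) by (intro filterlim_subseq) (simp add: strict_mono_def)
  then show "(\<lambda>N. \<Prod>n<N * m. 1 - w * q ^ n) \<longlonglongrightarrow> qp q w"
    by (rule filterlim_compose[OF qp_tendsto[OF assms(1)]])
  have qm: "norm (q ^ m) < 1" using assms by (simp add: norm_power power_less_one_iff)
  have "(\<Prod>n<N * m. 1 - w * q ^ n) = (\<Prod>j<m. \<Prod>n<N. 1 - (w * q ^ j) * (q ^ m) ^ n)" for N
  proof -
    have "(\<Prod>n<N * m. 1 - w * q ^ n) = (\<Prod>n<N. \<Prod>k\<in>{n * m..<n * m + m}. 1 - w * q ^ k)"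
      by (rule prod.nat_group[symmetric])
    also have "\<dots> = (\<Prod>n<N. \<Prod>j<m. 1 - (w * q ^ j) * (q ^ m) ^ n)"
    proof (rule prod.cong[OF refl])
      fix n
      have "(\<Prod>k\<in>{n * m..<n * m + m}. 1 - w * q ^ k) = (\<Prod>j<m. 1 - w * q ^ (j + n * m))"
        by (intro prod.reindex_bij_witness[of _ "\<lambda>j. j + n * m" "\<lambda>k. k - n * m"]) auto
      then show "(\<Prod>k\<in>{n * m..<n * m + m}. 1 - w * q ^ k) = (\<Prod>j<m. 1 - (w * q ^ j) * (q ^ m) ^ n)"
        by (simp add: power_add mult_ac flip: power_mult)
    qed
    also have "\<dots> = (\<Prod>j<m. \<Prod>n<N. 1 - (w * q ^ j) * (q ^ m) ^ n)"
      by (rule prod.swap)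
    finally show ?thesis .
  qed
  then show "(\<lambda>N. \<Prod>n<N * m. 1 - w * q ^ n) \<longlonglongrightarrow> (\<Prod>j<m. qp (q ^ m) (w * q ^ j))"
    by (simp only:) (intro tendsto_prod qp_tendsto qm)
qed

lemma holomorphic_qp:
  assumes "norm q < 1"
  shows "qp q holomorphic_on A"
proof (rule holomorphic_on_subset)
  show "qp q holomorphic_on UNIV"
  proof (rule holomorphic_uniform_sequence)
    fix z :: complex
    have "uniform_limit (cball z 1) (\<lambda>N w. \<Prod>n<N. 1 - w * q ^ n) (\<lambda>w. \<Prod>n. 1 - w * q ^ n) sequentially"
    proof (rule uniform_limit_prodinf_M_test[OF _ compact_cball _ summable_qp[OF assms, of "norm z + 1"]])
      fix n w assume "w \<in> cball z 1"
      then have "norm w \<le> norm z + 1"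
        by (metis add.commute dist_commute dist_norm mem_cball norm_triangle_sub order_trans add_left_mono)
      then show "norm (1 - w * q ^ n - 1) \<le> (norm z + 1) * norm q ^ n"
        by (simp add: norm_mult norm_power mult_right_mono)
    qed (intro continuous_intros)
    then show "\<exists>d>0. cball z d \<subseteq> UNIV \<and>
        uniform_limit (cball z d) (\<lambda>N w. \<Prod>n<N. 1 - w * q ^ n) (qp q) sequentially"
      by (intro exI[of _ 1]) (auto simp: qp_def[abs_def])
  qed (auto intro!: holomorphic_intros)
qed auto

text \<open>On the diagonal the base varies together with the argument, so
  \<open>holomorphic_qp\<close>, where the base is fixed, does not cover it. On a closed disc of
  radius \<open>r < 1\<close> the geometric series in \<open>r\<close> is a majorant.\<close>

lemma uniform_limit_qp_diag:
  fixes r :: real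
  assumes "0 \<le> r" "r < 1"
  shows "uniform_limit (cball 0 r) (\<lambda>N w. \<Prod>n<N. 1 - w ^ Suc n) (\<lambda>w. qp w w) sequentially"
proof -
  have qp_eq: "qp w w = (\<Prod>n. 1 - w ^ Suc n)" for w by (simp add: qp_def)
  show ?thesis
    unfolding qp_eq
  proof (rule uniform_limit_prodinf_M_test)
    show "summable (\<lambda>n. r ^ Suc n)" using assms by (simp add: summable_geometric summable_mult)
    fix n and w :: complex assume "w \<in> cball 0 r"
    then show "norm (1 - w ^ Suc n - 1) \<le> r ^ Suc n"
      by (simp add: norm_mult norm_power mult_mono power_mono assms)
  qed (auto intro!: continuous_intros)
qed

lemma holomorphic_qp_diag: "(\<lambda>w. qp w w) holomorphic_on ball 0 1"
proof (rule holomorphic_uniform_sequence)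
  fix z :: complex assume "z \<in> ball 0 1"
  then have z: "norm z < 1" by simp
  define d where "d = (1 - norm z) / 2"
  have d: "d > 0" "norm z + d < 1" using z by (auto simp: d_def field_simps)
  have sub: "cball z d \<subseteq> cball 0 (norm z + d)"
    by (simp add: cball_subset_cball_iff)
  have "uniform_limit (cball z d) (\<lambda>N w. \<Prod>n<N. 1 - w ^ Suc n) (\<lambda>w. qp w w) sequentially"
    by (rule uniform_limit_on_subset[OF uniform_limit_qp_diag sub]) (use d in auto)
  moreover have "cball z d \<subseteq> ball 0 1" using sub d by (auto simp: subset_eq)
  ultimately show "\<exists>d>0. cball z d \<subseteq> ball 0 1 \<and>
      uniform_limit (cball z d) (\<lambda>N w. \<Prod>n<N. 1 - w ^ Suc n) (\<lambda>w. qp w w) sequentially"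
    using d by blast
qed (auto intro!: holomorphic_intros)

lemma logderiv_qp_diag:
  assumes "norm w < 1"
  shows "(\<lambda>n. - (of_nat (Suc n) * w ^ n / (1 - w ^ Suc n))) sums (deriv (\<lambda>w. qp w w) w / qp w w)"
proof -
  define r where "r = (norm w + 1) / 2"
  have r: "norm w < r" "0 \<le> r" "r < 1" using assms by (auto simp: r_def add_pos_nonneg field_simps)
  have "uniform_limit (ball 0 r) (\<lambda>N w. \<Prod>n<N. 1 - w ^ Suc n) (\<lambda>w. qp w w) sequentially"
    using uniform_limit_qp_diag[OF r(2,3)] by (rule uniform_limit_on_subset) auto
  then have "(\<lambda>n. deriv (\<lambda>w. 1 - w ^ Suc n) w / (1 - w ^ Suc n)) sums (deriv (\<lambda>w. qp w w) w / qp w w)"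
    by (rule logderiv_prodinf_complex_uniform_limit)
       (use r qp_nonzero[OF assms assms] in \<open>auto intro!: holomorphic_intros\<close>)
  moreover have "deriv (\<lambda>w. 1 - w ^ Suc n) w = - (of_nat (Suc n) * w ^ n)" for n
    by (rule DERIV_imp_deriv) (auto intro!: derivative_eq_intros simp del: power_Suc)
  ultimately show ?thesis by simp
qed

section \<open>Lambert series\<close>

lemma sums_of_nat_times_power:
  fixes z :: complex
  assumes "norm z < 1"
  shows "(\<lambda>n. of_nat n * z ^ n) sums (z / (1 - z)\<^sup>2)"
proof -
  have "(\<lambda>n. z * (of_nat (Suc n) * z ^ n)) sums (z * (1 / (1 - z)\<^sup>2))"
    by (intro sums_mult geometric_deriv_sums assms)
  then have "(\<lambda>n. of_nat (Suc n) * z ^ Suc n) sums (z / (1 - z)\<^sup>2)"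
    by (simp add: mult_ac)
  then show ?thesis
    using sums_Suc_iff[of "\<lambda>n. of_nat n * z ^ n"] by simp
qed

text \<open>The term for \<open>m = 0\<close> is 0, although it contains the quotient \<open>1 / 0\<close>.\<close>
definition lambert :: "complex \<Rightarrow> complex \<Rightarrow> complex" where
  "lambert q w = (\<Sum>m. of_nat m * (q ^ m / (1 - q ^ m)) * w ^ m)"

lemma sums_lambert:
  assumes q: "norm q < 1" and qw: "norm (q * w) < 1"
  shows "(\<lambda>m. of_nat m * (q ^ m / (1 - q ^ m)) * w ^ m) sums lambert q w"
  unfolding lambert_def
proof (rule summable_sums, rule summable_comparison_test')
  \<comment> \<open>The complex power series, taken at the real point \<open>norm (q * w)\<close>,
    supplies the real majorant.\<close>
  have "summable (\<lambda>m. of_nat m * norm (q * w) ^ m :: complex)"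
    using sums_of_nat_times_power[of "of_real (norm (q * w))"] qw sums_summable by force
  then have "summable (\<lambda>m. of_nat m * norm (q * w) ^ m)"
    using summable_of_real_iff[where ?'a = complex, of "\<lambda>m. of_nat m * norm (q * w) ^ m"] by simp
  then show "summable (\<lambda>m. of_nat m * norm (q * w) ^ m / (1 - norm q))"
    by (rule summable_divide)
  fix m :: nat
  show "norm (of_nat m * (q ^ m / (1 - q ^ m)) * w ^ m) \<le> of_nat m * norm (q * w) ^ m / (1 - norm q)"
  proof (cases "m = 0")
    case False
    have "norm q ^ m \<le> norm q ^ 1"
      using q False by (intro power_decreasing) auto
    then have "1 - norm q \<le> 1 - norm (q ^ m)" by (simp add: norm_power)
    also have "\<dots> \<le> norm (1 - q ^ m)"
      using norm_triangle_ineq2[of 1 "q ^ m"] by simp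
    finally have "1 - norm q \<le> norm (1 - q ^ m)" .
    then have "of_nat m * norm (q * w) ^ m / norm (1 - q ^ m) \<le> of_nat m * norm (q * w) ^ m / (1 - norm q)"
      using q by (intro divide_left_mono mult_pos_pos) auto
    then show ?thesis
      by (simp add: norm_mult norm_divide norm_power power_mult_distrib mult_ac)
  qed auto
qed

text \<open>Passing from w to q w changes the m-th term by m (q w)^m, because q^m / (1 - q^m) * (1 -
  q^m) = q^m. The differences sum to the closed form of
  \<open>sums_of_nat_times_power\<close>.\<close>

lemma lambert_rec:
  assumes q: "norm q < 1" and qw: "norm (q * w) < 1"
  shows "lambert q w = lambert q (q * w) + q * w / (1 - q * w)\<^sup>2"
proof (rule sums_unique2[OF sums_lambert[OF assms]])
  have "norm q * norm (q * w) \<le> 1 * norm (q * w)"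
    using q by (intro mult_right_mono) auto
  then have "norm (q * (q * w)) < 1" using qw by (simp add: norm_mult)
  from sums_add[OF sums_lambert[OF q this] sums_of_nat_times_power[OF qw]]
  have "(\<lambda>m. of_nat m * (q ^ m / (1 - q ^ m)) * (q * w) ^ m + of_nat m * (q * w) ^ m)
          sums (lambert q (q * w) + q * w / (1 - q * w)\<^sup>2)" .
  moreover have "of_nat m * (q ^ m / (1 - q ^ m)) * (q * w) ^ m + of_nat m * (q * w) ^ m =
                 of_nat m * (q ^ m / (1 - q ^ m)) * w ^ m" for m
  proof (cases "m = 0")
    case False
    then have "norm (q ^ m) < 1" using q by (simp add: norm_power power_less_one_iff)
    then have "1 - q ^ m \<noteq> 0" by auto
    then show ?thesis by (simp add: field_simps power_mult_distrib)
  qed auto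
  ultimately show "(\<lambda>m. of_nat m * (q ^ m / (1 - q ^ m)) * w ^ m)
      sums (lambert q (q * w) + q * w / (1 - q * w)\<^sup>2)"
    by simp
qed

lemma holomorphic_lambert:
  assumes "norm q < 1" "q \<noteq> 0"
  shows "lambert q holomorphic_on ball 0 (1 / norm q)"
proof (rule power_series_holomorphic)
  fix w :: complex assume "w \<in> ball 0 (1 / norm q)"
  then have "norm (q * w) < 1"
    using assms by (simp add: norm_mult pos_less_divide_eq mult.commute)
  then show "(\<lambda>m. of_nat m * (q ^ m / (1 - q ^ m)) * (w - 0) ^ m) sums lambert q w"
    using sums_lambert[OF assms(1)] by simp
qed

lemma deriv_qp_diag:
  assumes "norm w < 1"
  shows "w * deriv (\<lambda>w. qp w w) w = - qp w w * lambert w 1"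
proof -
  have "(\<lambda>n. - w * - (of_nat (Suc n) * w ^ n / (1 - w ^ Suc n))) sums (- w * (deriv (\<lambda>w. qp w w) w / qp w w))"
    by (intro sums_mult logderiv_qp_diag assms)
  \<comment> \<open>The products are indexed from exponent 1 and \<open>lambert\<close> from 0; its
    term at 0 vanishes.\<close>
  then have "(\<lambda>m. of_nat m * (w ^ m / (1 - w ^ m)) * 1 ^ m) sums (- w * (deriv (\<lambda>w. qp w w) w / qp w w))"
    using sums_Suc_iff[of "\<lambda>m. of_nat m * (w ^ m / (1 - w ^ m)) * 1 ^ m"] by (simp add: mult_ac)
  from sums_unique2[OF this sums_lambert] show ?thesis
    using assms qp_nonzero[OF assms assms] by (simp add: field_simps minus_equation_iff)
qed

section \<open>Theta function and Weierstrass function in the multiplicative coordinate\<close>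

text \<open>By the Jacobi triple product this is the theta series sum (-1)^n q^(n(n-1)/2) z^n over
  all integers n, divided by (q; q)_inf. Its zeros on z \<noteq> 0 are simple and are the integral
  powers of q, for 0 < |q| < 1.\<close>

definition theta :: "complex \<Rightarrow> complex \<Rightarrow> complex" where
  "theta q z = qp q z * qp q (q / z)"

text \<open>This splits off the zero at 1, the only one in the annulus |q| < |z| < 1/|q|;
  \<open>qp_mult_qp_nonzero\<close> treats the cofactor.\<close>

lemma theta_eq:
  assumes "norm q < 1"
  shows "theta q z = (1 - z) * (qp q (q * z) * qp q (q / z))"
  using qp_rec[OF assms, of z] by (simp add: theta_def)

lemma theta_inverse:
  assumes "norm q < 1" "z \<noteq> 0"
  shows "theta q (1 / z) = - theta q z / z"
  using assms by (simp add: theta_eq field_simps)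

text \<open>The substitution z -> q / z swaps the two factors of \<open>theta\<close>, so z -> q z
  has the same effect as z -> 1 / z.\<close>

lemma theta_mult:
  assumes "norm q < 1" "q \<noteq> 0" "z \<noteq> 0"
  shows "theta q (q * z) = - theta q z / z"
proof -
  have "theta q (q * z) = theta q (1 / z)"
    using assms by (simp add: theta_def)
  with theta_inverse[OF assms(1,3)] show ?thesis by simp
qed

text \<open>The Weierstrass \<open>\<wp>\<close>-function of the curve \<open>\<complex>\<^sup>* / q\<^sup>\<int>\<close> in the coordinate \<open>z = exp u\<close>, up to an
  additive constant. The series converge only for \<open>norm q < norm z < 1 / norm q\<close>; this annulus
  contains a fundamental domain together with its boundary.\<close>
definition ell :: "complex \<Rightarrow> complex \<Rightarrow> complex" where
  "ell q z = z / (1 - z)\<^sup>2 + lambert q z + lambert q (1 / z)"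

lemma ell_inverse: "z \<noteq> 0 \<Longrightarrow> ell q (1 / z) = ell q z"
  by (cases "z = 1") (auto simp: ell_def field_simps power2_eq_square)

text \<open>The polar terms are exchanged: \<open>lambert_rec\<close> at z releases q z / (1 - q
  z)^2, the polar term of \<open>ell q (q * z)\<close>, and at 1 / (q z) it releases the polar term
  of \<open>ell q z\<close>. The bounds on z keep both z and q z inside the annulus of
  convergence.\<close>

lemma ell_mult:
  assumes q: "norm q < 1" "q \<noteq> 0" and z: "1 < norm z" "norm z < 1 / norm q"
  shows "ell q (q * z) = ell q z"
proof -
  have "z \<noteq> 0" "z \<noteq> 1" using z by auto
  have "norm (q * z) < 1" using z q by (simp add: norm_mult field_simps)
  from lambert_rec[OF q(1) this]
  have 1: "lambert q z = lambert q (q * z) + q * z / (1 - q * z)\<^sup>2" .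
  have "norm (q * (1 / (q * z))) < 1"
    using z q less_trans[OF zero_less_one z(1)] by (simp add: norm_divide pos_divide_less_eq)
  from lambert_rec[OF q(1) this]
  have "lambert q (1 / (q * z)) = lambert q (1 / z) + (1 / z) / (1 - 1 / z)\<^sup>2"
    using q by simp
  also have "(1 / z) / (1 - 1 / z)\<^sup>2 = z / (1 - z)\<^sup>2"
    using \<open>z \<noteq> 0\<close> \<open>z \<noteq> 1\<close> by (simp add: field_simps power2_eq_square)
  finally show ?thesis using 1 by (simp add: ell_def)
qed

section \<open>The difference formula for the Weierstrass function\<close>

text \<open>Multiplication by q or 1/q moves every point of the annulus outside the compact ring
  sqrt |q| \<le> |z| \<le> 1 / sqrt |q| into that ring. So the maximum of |g| on the ring is a
  maximum on the whole open annulus, and it is attained at an interior point.\<close>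

lemma constant_on_annulus:
  assumes q: "norm q < 1" "q \<noteq> 0"
    and hol: "g holomorphic_on {z. norm q < norm z \<and> norm z < 1 / norm q}" (is "_ holomorphic_on ?A")
    and per: "\<And>z. 1 < norm z \<Longrightarrow> norm z < 1 / norm q \<Longrightarrow> g (q * z) = g z"
  shows "g constant_on ?A"
proof -
  define s where "s = sqrt (norm q)"
  have s: "0 < s" "s < 1" "norm q = s * s" using q by (auto simp: s_def)
  define K where "K = {z :: complex. s \<le> norm z \<and> norm z \<le> 1 / s}"
  have "s * s < s" using s by simp
  have "1 / s < 1 / (s * s)" using s \<open>s * s < s\<close> by (intro divide_strict_left_mono) auto
  have KA: "K \<subseteq> ?A"
    using \<open>s * s < s\<close> \<open>1 / s < 1 / (s * s)\<close> by (auto simp: K_def s(3))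
  have "closed {z :: complex. s \<le> norm z}" "closed {z :: complex. norm z \<le> 1 / s}"
    by (intro closed_Collect_le continuous_intros)+
  moreover have "bounded K"
    by (rule bounded_subset[of "cball 0 (1 / s)"]) (auto simp: K_def)
  ultimately have "compact K"
    by (auto simp: compact_eq_bounded_closed K_def Collect_conj_eq intro: closed_Int)
  moreover have "1 \<in> K" using s by (auto simp: K_def field_simps)
  moreover have "continuous_on K (\<lambda>z. norm (g z))"
    using holomorphic_on_imp_continuous_on[OF holomorphic_on_subset[OF hol KA]] by (intro continuous_intros)
  ultimately obtain \<xi> where \<xi>: "\<xi> \<in> K" "\<And>z. z \<in> K \<Longrightarrow> norm (g z) \<le> norm (g \<xi>)"
    using continuous_attains_sup[of K "\<lambda>z. norm (g z)"] by blast
  have "norm (g z) \<le> norm (g \<xi>)" if z: "z \<in> ?A" for z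
  proof -
    have z': "s * s < norm z" "norm z * (s * s) < 1" using z s by (auto simp: field_simps)
    consider "z \<in> K" | "norm z > 1 / s" | "norm z < s" unfolding K_def by fastforce
    then show ?thesis
    proof cases
      case 1 then show ?thesis by (rule \<xi>)
    next
      case 2
      have "1 / s > 1" using s by simp
      then have "1 < norm z" using 2 by simp
      then have "g (q * z) = g z" using z by (intro per) auto
      moreover have "s < s * (s * norm z)" using 2 s by (simp add: field_simps)
      moreover have "norm (q * z) = s * (s * norm z)" by (simp add: norm_mult s(3))
      moreover have "s * (s * norm z) < 1" using z' by (simp add: mult_ac)
      ultimately have "q * z \<in> K" "g (q * z) = g z"
        using \<open>1 / s > 1\<close> unfolding K_def by auto
      then show ?thesis using \<xi>(2) by metis
    next
      case 3
      have n: "norm (z / q) = norm z / (s * s)" by (simp add: norm_divide s(3))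
      have "1 < norm (z / q)" unfolding n using z' s by (simp add: field_simps)
      moreover have lt: "norm (z / q) < 1 / s" unfolding n using 3 s by (simp add: field_simps)
      then have "norm (z / q) < 1 / norm q" using \<open>1 / s < 1 / (s * s)\<close> by (simp add: s(3))
      ultimately have "g (q * (z / q)) = g (z / q)" by (intro per)
      then have "g z = g (z / q)" using q by simp
      moreover have "z / q \<in> K" using \<open>1 < norm (z / q)\<close> lt s by (auto simp: K_def)
      ultimately show ?thesis using \<xi>(2) by metis
    qed
  qed
  moreover have "connected ?A" using connected_annulus(1)[of "norm q" "0 :: complex" "1 / norm q"] by simp
  moreover have "open ?A"
    by (intro open_Collect_conj open_Collect_less continuous_intros)
  ultimately show ?thesis
    using \<xi>(1) KA by (intro maximum_modulus_principle[OF hol, of ?A \<xi>]) auto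
qed


text \<open>Two successive difference quotients, each holomorphic by the removable singularity
  theorem. In \<open>ell_diff\<close> this removes the double pole at 1.\<close>

lemma double_zero_quotient:
  fixes K :: "complex \<Rightarrow> complex"
  assumes "K holomorphic_on S" "open S" "K a = 0" "deriv K a = 0"
  obtains g where "g holomorphic_on S" "\<And>z. z \<noteq> a \<Longrightarrow> K z = (z - a)\<^sup>2 * g z"
proof -
  define h where "h = (\<lambda>z. if z = a then deriv K a else (K z - K a) / (z - a))"
  define g where "g = (\<lambda>z. if z = a then deriv h a else (h z - h a) / (z - a))"
  have "h holomorphic_on S" unfolding h_def using assms by (intro pole_lemma_open)
  then have "g holomorphic_on S" unfolding g_def using assms by (intro pole_lemma_open)
  moreover have "K z = (z - a)\<^sup>2 * g z" if "z \<noteq> a" for z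
    using that assms by (simp add: g_def h_def power2_eq_square)
  ultimately show ?thesis by (rule that)
qed

lemma qp_mult_qp_nonzero:
  assumes q: "norm q < 1" and z: "norm q < norm z" "norm z < 1 / norm q"
  shows "qp q (q * z) * qp q (q / z) \<noteq> 0"
proof -
  have "norm z > 0" using z by (meson norm_ge_zero order_le_less_trans)
  moreover have "norm q > 0" using z by (cases "q = 0") auto
  ultimately have "norm (q * z) < 1" "norm (q / z) < 1"
    using q z by (auto simp: norm_mult norm_divide field_simps)
  then show ?thesis using qp_nonzero[OF q] by simp
qed

lemma theta_nonzero:
  assumes "norm q < 1" "norm q < norm z" "norm z < 1 / norm q" "z \<noteq> 1"
  shows "theta q z \<noteq> 0"
  using qp_mult_qp_nonzero[OF assms(1-3)] assms(1,4) by (simp add: theta_eq)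

lemma ell_diff:
  assumes q: "norm q < 1" "q \<noteq> 0"
    and a: "norm q < norm a" "norm a < 1 / norm q" "a \<noteq> 1"
    and b: "norm q < norm b" "norm b < 1 / norm q" "b \<noteq> 1"
  shows "ell q a - ell q b = - b * qp q q ^ 4 * theta q (a * b) * theta q (a / b) / ((theta q a)\<^sup>2 * (theta q b)\<^sup>2)"
proof -
  define A where "A = {z :: complex. norm q < norm z \<and> norm z < 1 / norm q}"
  define \<phi> where "\<phi> = (\<lambda>z. qp q (q * z) * qp q (q / z))"
  define C where "C = - b * qp q q ^ 4 / (theta q b)\<^sup>2"
  define P where "P = (\<lambda>z. theta q (z * b) * theta q (z / b))"
  \<comment> \<open>\<open>h\<close> is the difference of the two sides as a function of z, and
    \<open>K\<close> is (1 - z)^2 h with the division at 1 already carried out, by means of theta(z)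
    = (1 - z) phi(z). The constant \<open>C\<close> makes the leading polar coefficients at 1
    cancel, as \<open>K1\<close> verifies.\<close>
  define K where "K = (\<lambda>z. z + (1 - z)\<^sup>2 * (lambert q z + lambert q (1 / z) - ell q b) - C * P z / (\<phi> z)\<^sup>2)"
  define h where "h = (\<lambda>z. ell q z - ell q b - C * P z / (theta q z)\<^sup>2)"
  have "b \<noteq> 0" using b q by auto
  have A0: "z \<noteq> 0" if "z \<in> A" for z using that q by (auto simp: A_def)
  have inv: "1 / z \<in> A" if "z \<in> A" for z
    using that q A0[OF that] by (auto simp: A_def norm_divide field_simps)
  have "1 \<in> A" using q by (auto simp: A_def)
  have openA: "open A" unfolding A_def
    by (intro open_Collect_conj open_Collect_less continuous_intros)
  have \<phi>0: "\<phi> z \<noteq> 0" if "z \<in> A" for z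
    using qp_mult_qp_nonzero[OF q(1)] that by (simp add: \<phi>_def A_def)
  have qp_hol: "(\<lambda>z. qp q (f z)) holomorphic_on A" if "f holomorphic_on A" for f
    using holomorphic_on_compose[OF that holomorphic_qp[OF q(1)]] by (simp add: o_def)
  have lam_hol: "(\<lambda>z. lambert q (f z)) holomorphic_on A" if "f holomorphic_on A" "f ` A \<subseteq> A" for f
  proof -
    have "A \<subseteq> ball 0 (1 / norm q)" by (auto simp: A_def)
    with that(2) have "lambert q holomorphic_on f ` A"
      using holomorphic_on_subset[OF holomorphic_lambert[OF q]] by blast
    with holomorphic_on_compose[OF that(1)] show ?thesis by (simp add: o_def)
  qed
  have Khol: "K holomorphic_on A"
    unfolding K_def P_def \<phi>_def theta_def
    by (intro holomorphic_intros qp_hol lam_hol)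
       (use A0 inv \<phi>0 \<open>b \<noteq> 0\<close> in \<open>auto simp: \<phi>_def\<close>)
  have Kh: "K z = (z - 1)\<^sup>2 * h z" if "z \<noteq> 1" for z
    using that by (simp add: K_def h_def ell_def theta_eq[OF q(1), of z] \<phi>_def divide_simps)
                  (simp add: algebra_simps power2_eq_square)
  \<comment> \<open>Signs and powers of b cancel between the two theta factors. \<open>P\<close>
    thus acquires the factor z^(-2), as theta(z)^2 does, so that their quotient is invariant; the
    same happens in \<open>P_mult\<close>.\<close>
  have P_inv: "P (1 / z) = P z / z\<^sup>2" if "z \<noteq> 0" for z
  proof -
    have "P (1 / z) = theta q (1 / (z / b)) * theta q (1 / (z * b))" by (simp add: P_def)
    also have "\<dots> = (- theta q (z / b) / (z / b)) * (- theta q (z * b) / (z * b))"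
      using theta_inverse[OF q(1), of "z / b"] theta_inverse[OF q(1), of "z * b"] that \<open>b \<noteq> 0\<close>
      by (simp only: divide_eq_0_iff mult_eq_0_iff simp_thms)
    also have "\<dots> = P z / z\<^sup>2"
      using that \<open>b \<noteq> 0\<close> by (simp add: P_def power2_eq_square)
    finally show ?thesis .
  qed
  have P_mult: "P (q * z) = P z / z\<^sup>2" if "z \<noteq> 0" for z
  proof -
    have "P (q * z) = theta q (q * (z * b)) * theta q (q * (z / b))" by (simp add: P_def mult_ac)
    also have "\<dots> = (- theta q (z * b) / (z * b)) * (- theta q (z / b) / (z / b))"
      using theta_mult[OF q, of "z * b"] theta_mult[OF q, of "z / b"] that \<open>b \<noteq> 0\<close>
      by (simp only: divide_eq_0_iff mult_eq_0_iff simp_thms)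
    also have "\<dots> = P z / z\<^sup>2"
      using that \<open>b \<noteq> 0\<close> by (simp add: P_def power2_eq_square)
    finally show ?thesis .
  qed
  have h_inv: "h (1 / z) = h z" if "z \<noteq> 0" for z
    using that by (simp add: h_def P_inv theta_inverse[OF q(1)] ell_inverse power_divide)
  have h_mult: "h (q * z) = h z" if "1 < norm z" "norm z < 1 / norm q" for z
  proof -
    have "z \<noteq> 0" using that by auto
    then show ?thesis
      by (simp add: h_def P_mult theta_mult[OF q] ell_mult[OF q that] power_divide)
  qed
  have K1: "K 1 = 0"
  proof -
    have "theta q (1 / b) = - theta q b / b" using theta_inverse[OF q(1) \<open>b \<noteq> 0\<close>] .
    then have "P 1 = - (theta q b)\<^sup>2 / b" by (simp add: P_def power2_eq_square)
    moreover have "theta q b \<noteq> 0" using theta_nonzero[OF q(1) b] by simp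
    moreover have "\<phi> 1 = qp q q ^ 2" by (simp add: \<phi>_def power2_eq_square)
    moreover have "qp q q \<noteq> 0" by (rule qp_nonzero) (use q in auto)
    ultimately show ?thesis
      using \<open>b \<noteq> 0\<close> by (simp add: K_def C_def field_simps)
  qed
  \<comment> \<open>The symmetry \<open>z \<mapsto> 1 / z\<close> of \<open>h\<close> excludes a simple pole at 1.\<close>
  have K1': "deriv K 1 = 0"
  proof -
    have D: "(K has_field_derivative deriv K 1) (at 1)"
      using holomorphic_derivI[OF Khol openA \<open>1 \<in> A\<close>] .
    have "((\<lambda>z :: complex. 1 / z) has_field_derivative - 1) (at 1)"
      by (auto intro!: derivative_eq_intros)
    then have "((\<lambda>z. K (1 / z)) has_field_derivative deriv K 1 * - 1) (at 1)"
      using D by (intro DERIV_chain2[where f = K]) auto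
    \<comment> \<open>Because K(1) = 0, only the term -K'(1) of the product rule survives;
      comparison with K(z) = z^2 K(1/z) gives K'(1) = -K'(1).\<close>
    from DERIV_mult[OF DERIV_power[OF DERIV_ident, of 2] this]
    have "((\<lambda>z. z\<^sup>2 * K (1 / z)) has_field_derivative - deriv K 1) (at 1)"
      by (simp add: K1)
    moreover have ev: "\<forall>\<^sub>F z in nhds 1. K z = z\<^sup>2 * K (1 / z)"
      unfolding eventually_nhds
    proof (intro exI[of _ A] conjI ballI openA \<open>1 \<in> A\<close>)
      fix z assume "z \<in> A"
      then have "z \<noteq> 0" by (rule A0)
      then show "K z = z\<^sup>2 * K (1 / z)"
      proof (cases "z = 1")
        case False
        then have "1 / z \<noteq> 1" using \<open>z \<noteq> 0\<close> by simp
        from Kh[OF this] Kh[OF False] h_inv[OF \<open>z \<noteq> 0\<close>]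
        have "z\<^sup>2 * K (1 / z) = z\<^sup>2 * (1 / z - 1)\<^sup>2 * h z" "K z = (z - 1)\<^sup>2 * h z" by simp_all
        moreover have "z\<^sup>2 * (1 / z - 1)\<^sup>2 = (z - 1)\<^sup>2"
          using \<open>z \<noteq> 0\<close> by (simp add: field_simps power2_eq_square)
        ultimately show ?thesis by simp
      qed simp
    qed
    ultimately have "(K has_field_derivative - deriv K 1) (at 1)"
      by (simp only: DERIV_cong_ev[OF refl ev refl])
    from DERIV_unique[OF D this] show ?thesis by (simp add: eq_neg_iff_add_eq_0)
  qed
  obtain g where g: "g holomorphic_on A" "\<And>z. z \<noteq> 1 \<Longrightarrow> K z = (z - 1)\<^sup>2 * g z"
    using double_zero_quotient[OF Khol openA K1 K1'] by metis
  \<comment> \<open>At 1 the value of \<open>h\<close> comes from division by zero, so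
    \<open>g\<close> and \<open>h\<close> are compared only away from 1.\<close>
  have gh: "g z = h z" if "z \<noteq> 1" for z
    using g(2)[OF that] Kh[OF that] that by simp
  have "g constant_on A"
    unfolding A_def
  proof (rule constant_on_annulus[OF q g(1)[unfolded A_def]])
    fix z :: complex assume z: "1 < norm z" "norm z < 1 / norm q"
    have "norm (q * z) < 1" using z q by (simp add: norm_mult field_simps)
    then have "q * z \<noteq> 1" "z \<noteq> 1" using z by auto
    then show "g (q * z) = g z" using h_mult[OF z] gh by simp
  qed
  then have "g a = g b"
    using a b by (auto simp: constant_on_def A_def)
  \<comment> \<open>The factor theta(z / b) of P(z) vanishes at z = b.\<close>
  moreover have "theta q 1 = 0" by (simp add: theta_eq[OF q(1)])
  then have "h b = 0" using \<open>b \<noteq> 0\<close> by (simp add: h_def P_def)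
  ultimately have "h a = 0" using gh a b by simp
  then show ?thesis by (simp add: h_def P_def C_def eq_neg_iff_add_eq_0 mult_ac)
qed


section \<open>The Lambert series of the logarithmic derivative of W\<close>

lemma sums_ell:
  assumes q: "norm q < 1" and z: "norm q < norm z" "norm z < 1"
  shows "(\<lambda>m. of_nat m * (z ^ m + q ^ m / (1 - q ^ m) * (z ^ m + (1 / z) ^ m))) sums ell q z"
proof -
  have "norm q * norm z < 1 * 1"
    using q z by (intro mult_strict_mono') auto
  then have 1: "norm (q * z) < 1" by (simp add: norm_mult)
  have 2: "norm (q * (1 / z)) < 1"
    using z by (simp add: norm_divide pos_divide_less_eq[OF le_less_trans[OF norm_ge_zero z(1)]])
  show ?thesis
    using sums_add[OF sums_add[OF sums_of_nat_times_power[OF z(2)] sums_lambert[OF q 1]] sums_lambert[OF q 2]]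
    by (simp add: ell_def algebra_simps add_divide_distrib)
qed

text \<open>The powers are arranged as \<open>(x ^ m) ^ k\<close> so that, for fixed m, the terms
  for all k are rational functions of the one quantity y = x^m.\<close>

lemma sums_lambert_1:
  assumes "norm x < 1" "k > 0"
  shows "(\<lambda>m. of_nat m * ((x ^ m) ^ k / (1 - (x ^ m) ^ k))) sums lambert (x ^ k) 1"
proof -
  have "norm (x ^ k) < 1" using assms by (simp add: norm_power power_less_one_iff)
  from sums_lambert[OF this, of 1] this show ?thesis
    by (simp add: mult.commute flip: power_mult)
qed

text \<open>The series agree term by term: with y = x^m and m > 0, both terms are m (y - 2 y^3 +
  y^5) / (1 - y^6).\<close>

lemma ell_diff_lambert:
  fixes x :: complex
  assumes x: "x \<noteq> 0" "norm x < 1"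
  shows "ell (x ^ 6) x - ell (x ^ 6) (x ^ 3) =
    lambert x 1 - lambert (x ^ 2) 1 - 3 * lambert (x ^ 3) 1 + 3 * lambert (x ^ 6) 1"
proof (rule sums_unique2)
  have less: "norm x ^ j < norm x ^ i" if "i < j" for i j :: nat
    using x that by (intro power_strict_decreasing) auto
  have "norm (x ^ 6) < 1" using x by (simp add: norm_power power_less_one_iff)
  have 1: "(\<lambda>m. of_nat m * (x ^ m + (x ^ 6) ^ m / (1 - (x ^ 6) ^ m) * (x ^ m + (1 / x) ^ m))) sums ell (x ^ 6) x"
    using less[of 1 6] x \<open>norm (x ^ 6) < 1\<close> by (intro sums_ell) (auto simp: norm_power)
  have 2: "(\<lambda>m. of_nat m * ((x ^ 3) ^ m + (x ^ 6) ^ m / (1 - (x ^ 6) ^ m) * ((x ^ 3) ^ m + (1 / x ^ 3) ^ m)))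
      sums ell (x ^ 6) (x ^ 3)"
    using less[of 3 6] less[of 0 3] x \<open>norm (x ^ 6) < 1\<close> by (intro sums_ell) (auto simp: norm_power)
  let ?d = "\<lambda>m k. (x ^ m) ^ k / (1 - (x ^ m) ^ k)"
  let ?f = "\<lambda>m. of_nat m * ?d m 1 - of_nat m * ?d m 2 - 3 * (of_nat m * ?d m 3) + 3 * (of_nat m * ?d m 6)"
  show "?f sums (lambert x 1 - lambert (x ^ 2) 1 - 3 * lambert (x ^ 3) 1 + 3 * lambert (x ^ 6) 1)"
    using sums_lambert_1[OF x(2), of 1]
    by (intro sums_add sums_diff sums_mult sums_lambert_1 x) auto
  have "?f m = of_nat m * (x ^ m + (x ^ 6) ^ m / (1 - (x ^ 6) ^ m) * (x ^ m + (1 / x) ^ m)) -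
      of_nat m * ((x ^ 3) ^ m + (x ^ 6) ^ m / (1 - (x ^ 6) ^ m) * ((x ^ 3) ^ m + (1 / x ^ 3) ^ m))" for m
  proof (cases "m = 0")
    case False
    define y where "y = x ^ m"
    have y: "norm y < 1" "y \<noteq> 0" using x False by (auto simp: y_def norm_power power_less_one_iff)
    have nz: "1 - y ^ k \<noteq> 0" if "k > 0" for k
    proof -
      have "norm (y ^ k) < 1" using y that by (simp add: norm_power power_less_one_iff)
      then show ?thesis by auto
    qed
    \<comment> \<open>The three fractions are brought to the common denominator 1 - y^6.\<close>
    have e1: "y / (1 - y) = (y + y^2 + y^3 + y^4 + y^5 + y^6) / (1 - y ^ 6)"
      using nz[of 1] nz[of 6] by (simp add: divide_simps) algebra
    have e2: "y^2 / (1 - y^2) = (y^2 + y^4 + y^6) / (1 - y ^ 6)"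
      using nz[of 2] nz[of 6] by (simp add: divide_simps) algebra
    have e3: "y^3 / (1 - y^3) = (y^3 + y^6) / (1 - y ^ 6)"
      using nz[of 3] nz[of 6] by (simp add: divide_simps) algebra
    have "y / (1 - y) - y^2 / (1 - y^2) - 3 * (y^3 / (1 - y^3)) + 3 * (y^6 / (1 - y^6)) =
        (y + y^6 / (1 - y^6) * (y + 1 / y)) - (y^3 + y^6 / (1 - y^6) * (y^3 + 1 / y^3))"
      unfolding e1 e2 e3 using nz[of 6] y(2) by (simp add: divide_simps) algebra
    from arg_cong[OF this, of "\<lambda>t. of_nat m * t"] show ?thesis
      by (simp add: y_def algebra_simps power_divide flip: power_mult)
  qed auto
  then show "?f sums (ell (x ^ 6) x - ell (x ^ 6) (x ^ 3))"
    using sums_diff[OF 1 2] by simp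
qed

section \<open>Euler products by residue classes modulo 6\<close>

text \<open>\<open>A\<close>, \<open>B\<close>, \<open>C\<close>, \<open>D\<close> collect the
  factors 1 - x^n of (x; x)_inf with n congruent to 1 or 5, 2 or 4, 3, and 0 modulo 6. In these
  terms the last two conclusions are \<open>ell_diff\<close> for base x^6 and the three-term
  relation for base x^3.\<close>

lemma eta_quotients:
  fixes x :: complex
  assumes x: "x \<noteq> 0" "norm x < 1"
  defines "A \<equiv> qp (x ^ 6) x * qp (x ^ 6) (x ^ 5)" and "B \<equiv> qp (x ^ 6) (x ^ 2) * qp (x ^ 6) (x ^ 4)"
    and "C \<equiv> qp (x ^ 6) (x ^ 3)" and "D \<equiv> qp (x ^ 6) (x ^ 6)"
  shows "qp x x = A * B * C * D" "qp (x ^ 2) (x ^ 2) = B * D" "qp (x ^ 3) (x ^ 3) = C * D"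
    and "A \<noteq> 0" "B \<noteq> 0" "C \<noteq> 0" "D \<noteq> 0"
    and "lambert x 1 - lambert (x ^ 2) 1 - 3 * lambert (x ^ 3) 1 + 3 * lambert (x ^ 6) 1 =
      x * B ^ 2 * D ^ 4 / (A ^ 2 * C ^ 4)"
    and "C ^ 6 = A ^ 8 * B ^ 4 * C ^ 6 + 8 * x * A ^ 3"
proof -
  have xk: "norm (x ^ k) < 1" if "k > 0" for k
    using x that by (simp add: norm_power power_less_one_iff)
  have qpk: "qp (x ^ i) (x ^ j) \<noteq> 0" if "i > 0" "j > 0" for i j
    using xk that by (intro qp_nonzero) auto
  have less: "norm x ^ j < norm x ^ i" if "i < j" for i j :: nat
    using x that by (intro power_strict_decreasing) auto
  have gt: "1 < 1 / norm x ^ k" if "k > 0" for k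
    using less[of 0 k] that x by simp
  show nz: "A \<noteq> 0" "B \<noteq> 0" "C \<noteq> 0" "D \<noteq> 0"
    using qpk[of 6 1] qpk[of 6] by (auto simp: A_def B_def C_def D_def)
  have "qp x x = (\<Prod>j<6. qp (x ^ 6) (x * x ^ j))" using x by (intro qp_split) auto
  also have "\<dots> = A * B * C * D"
    by (simp add: A_def B_def C_def D_def eval_nat_numeral mult_ac)
  finally show q1: "qp x x = A * B * C * D" .
  have "qp (x ^ 2) (x ^ 2) = (\<Prod>j<3. qp ((x ^ 2) ^ 3) (x ^ 2 * (x ^ 2) ^ j))"
    using xk by (intro qp_split) auto
  also have "\<dots> = B * D"
    by (simp add: B_def D_def eval_nat_numeral mult_ac)
  finally show q2: "qp (x ^ 2) (x ^ 2) = B * D" .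
  have "qp (x ^ 3) (x ^ 3) = (\<Prod>j<2. qp ((x ^ 3) ^ 2) (x ^ 3 * (x ^ 3) ^ j))"
    using xk by (intro qp_split) auto
  also have "\<dots> = C * D"
    by (simp add: C_def D_def eval_nat_numeral mult_ac)
  finally show q3: "qp (x ^ 3) (x ^ 3) = C * D" .

  \<comment> \<open>The symmetry z -> x^6 / z fixes x^3, hence the square, and exchanges x^2 with
    x^4, hence \<open>B\<close> for both.\<close>
  have t6: "theta (x ^ 6) x = A" "theta (x ^ 6) (x ^ 3) = C ^ 2"
      "theta (x ^ 6) (x * x ^ 3) = B" "theta (x ^ 6) (x ^ 2) = B"
    using x by (simp_all add: theta_def A_def B_def C_def eval_nat_numeral mult_ac)
  have "theta (x ^ 6) (x / x ^ 3) = theta (x ^ 6) (1 / x ^ 2)"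
    using x by (simp add: eval_nat_numeral)
  also have "\<dots> = - B / x ^ 2"
    using theta_inverse[of "x ^ 6" "x ^ 2"] xk[of 6] x t6 by simp
  finally have t6': "theta (x ^ 6) (x / x ^ 3) = - B / x ^ 2" .
  have "ell (x ^ 6) x - ell (x ^ 6) (x ^ 3) =
      - (x ^ 3) * qp (x ^ 6) (x ^ 6) ^ 4 * theta (x ^ 6) (x * x ^ 3) * theta (x ^ 6) (x / x ^ 3)
        / ((theta (x ^ 6) x)\<^sup>2 * (theta (x ^ 6) (x ^ 3))\<^sup>2)"
  proof (rule ell_diff)
    show "norm x < 1 / norm (x ^ 6)" "norm (x ^ 3) < 1 / norm (x ^ 6)"
      using gt[of 6] x(2) xk[of 3] by (auto simp: norm_power)
    show "x \<noteq> 1" "x ^ 3 \<noteq> 1" using x(2) xk[of 3] by (metis norm_one less_irrefl zero_less_numeral)+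
  qed (use x xk[of 6] less[of 1 6] less[of 3 6] in \<open>auto simp: norm_power\<close>)
  also have "\<dots> = x * B ^ 2 * D ^ 4 / (A ^ 2 * C ^ 4)"
    unfolding t6 t6' D_def[symmetric] using x nz by (simp add: field_simps eval_nat_numeral)
  finally show "lambert x 1 - lambert (x ^ 2) 1 - 3 * lambert (x ^ 3) 1 + 3 * lambert (x ^ 6) 1 =
      x * B ^ 2 * D ^ 4 / (A ^ 2 * C ^ 4)"
    using ell_diff_lambert[OF x] by simp

  \<comment> \<open>From here on the base is x^3. The exponents prime to 3 give theta(x), the
    multiples of 3 give \<open>C * D\<close>.\<close>
  have "qp x x = (\<Prod>j<3. qp (x ^ 3) (x * x ^ j))" using x by (intro qp_split) auto
  also have "\<dots> = theta (x ^ 3) x * qp (x ^ 3) (x ^ 3)"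
    using x by (simp add: theta_def eval_nat_numeral mult_ac)
  finally have "theta (x ^ 3) x * (C * D) = (A * B) * (C * D)"
    by (metis q1 q3 mult.assoc)
  then have t3: "theta (x ^ 3) x = A * B" using nz by simp
  \<comment> \<open>Pairing each argument with its negative squares the base to x^6.\<close>
  have "theta (x ^ 3) x * theta (x ^ 3) (- x) =
      (qp (x ^ 3) x * qp (x ^ 3) (- x)) * (qp (x ^ 3) (x ^ 2) * qp (x ^ 3) (- (x ^ 2)))"
    using x by (simp add: theta_def eval_nat_numeral mult_ac)
  also have "\<dots> = B"
    using qp_mult_minus[OF xk[of 3]] by (simp add: B_def flip: power_mult)
  finally have "A * theta (x ^ 3) (- x) = 1" using t3 nz by simp
  then have t3': "theta (x ^ 3) (- x) = 1 / A" using nz by (simp add: field_simps)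
  \<comment> \<open>The points -x^2 and -x are exchanged by z -> x^3 / z.\<close>
  have "theta (x ^ 3) (- (x ^ 2)) = theta (x ^ 3) (- x)"
    using x by (simp add: theta_def eval_nat_numeral mult_ac)
  then have t3'': "theta (x ^ 3) (x * (- x)) = 1 / A" using t3' by (simp add: power2_eq_square)
  have "qp (x ^ 3) (x ^ 3) * qp (x ^ 3) (- (x ^ 3)) = D"
    using qp_mult_minus[OF xk[of 3], of "x ^ 3"] by (simp add: D_def flip: power_mult)
  then have "qp (x ^ 3) (- (x ^ 3)) = 1 / C" using q3 nz by (simp add: field_simps)
  \<comment> \<open>\<open>qp_rec\<close> extracts 1 - (-1) = 2; both remaining products have
    argument -x^3.\<close>
  then have t31: "theta (x ^ 3) (- 1) = 2 / C ^ 2"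
    using qp_rec[OF xk[of 3], of "- 1"] by (simp add: theta_def power2_eq_square)

  have "x \<noteq> 1" "- x \<noteq> 1"
    using x(2) norm_minus_cancel[of x] by (metis norm_one less_irrefl)+
  moreover have "norm (x ^ 3) < norm x" "norm (x ^ 3) < 1" "1 < 1 / norm (x ^ 3)" "x ^ 3 \<noteq> 0"
    using less[of 1 3] xk[of 3] gt[of 3] x(1) by (auto simp: norm_power)
  moreover from this x(2) have "norm x < 1 / norm (x ^ 3)" by linarith
  ultimately have x3: "norm (x ^ 3) < norm x" "norm x < 1 / norm (x ^ 3)" "norm (x ^ 3) < 1"
    "1 < 1 / norm (x ^ 3)" "x \<noteq> 1" "- x \<noteq> 1" "x ^ 3 \<noteq> 0"
    by blast+
  note ell_diff3 = ell_diff[OF x3(3,7)]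
  have "ell (x ^ 3) x - ell (x ^ 3) (- 1) = C ^ 4 * D ^ 4 * (1 / A ^ 2) / ((A * B) ^ 2 * (2 / C ^ 2) ^ 2)"
    using ell_diff3[of x "- 1"] x3 x by (simp add: t3 t3' t31 q3 power2_eq_square power_mult_distrib)
  moreover have "ell (x ^ 3) (- x) - ell (x ^ 3) (- 1) = C ^ 4 * D ^ 4 * (A * B) ^ 2 / ((1 / A) ^ 2 * (2 / C ^ 2) ^ 2)"
    using ell_diff3[of "- x" "- 1"] x3 x by (simp add: t3 t3' t31 q3 power2_eq_square power_mult_distrib mult_ac)
  moreover have "ell (x ^ 3) x - ell (x ^ 3) (- x) = x * C ^ 4 * D ^ 4 * (1 / A) * (2 / C ^ 2) / ((A * B) ^ 2 * (1 / A) ^ 2)"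
    using ell_diff3[of x "- x"] x3 x t3'' by (simp add: t3 t3' t31 q3 power_mult_distrib mult.assoc)
  \<comment> \<open>The differences satisfy (ell(x) - ell(-1)) = (ell(-x) - ell(-1)) + (ell(x) -
    ell(-x)).\<close>
  ultimately have "C ^ 4 * D ^ 4 * (1 / A ^ 2) / ((A * B) ^ 2 * (2 / C ^ 2) ^ 2) =
      C ^ 4 * D ^ 4 * (A * B) ^ 2 / ((1 / A) ^ 2 * (2 / C ^ 2) ^ 2) +
      x * C ^ 4 * D ^ 4 * (1 / A) * (2 / C ^ 2) / ((A * B) ^ 2 * (1 / A) ^ 2)"
    by (simp add: algebra_simps)
  \<comment> \<open>The left side is C^8 D^4 / (4 A^4 B^2); the multiplier turns it into C^6 and
    clears the denominators on the right.\<close>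
  then have "4 * A ^ 4 * B ^ 2 / (C ^ 2 * D ^ 4) * (C ^ 4 * D ^ 4 * (1 / A ^ 2) / ((A * B) ^ 2 * (2 / C ^ 2) ^ 2)) =
      4 * A ^ 4 * B ^ 2 / (C ^ 2 * D ^ 4) * (C ^ 4 * D ^ 4 * (A * B) ^ 2 / ((1 / A) ^ 2 * (2 / C ^ 2) ^ 2) +
      x * C ^ 4 * D ^ 4 * (1 / A) * (2 / C ^ 2) / ((A * B) ^ 2 * (1 / A) ^ 2))" by simp
  also have "4 * A ^ 4 * B ^ 2 / (C ^ 2 * D ^ 4) * (C ^ 4 * D ^ 4 * (1 / A ^ 2) / ((A * B) ^ 2 * (2 / C ^ 2) ^ 2)) = C ^ 6"
    using nz by (simp add: field_simps eval_nat_numeral)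
  also have "4 * A ^ 4 * B ^ 2 / (C ^ 2 * D ^ 4) * (C ^ 4 * D ^ 4 * (A * B) ^ 2 / ((1 / A) ^ 2 * (2 / C ^ 2) ^ 2) +
      x * C ^ 4 * D ^ 4 * (1 / A) * (2 / C ^ 2) / ((A * B) ^ 2 * (1 / A) ^ 2)) = A ^ 8 * B ^ 4 * C ^ 6 + 8 * x * A ^ 3"
    using nz by (simp add: field_simps eval_nat_numeral)
  finally show "C ^ 6 = A ^ 8 * B ^ 4 * C ^ 6 + 8 * x * A ^ 3" .
qed

section \<open>The derivative of W with respect to tau\<close>

lemma norm_nome: "Im \<tau> > 0 \<Longrightarrow> norm (nome \<tau>) < 1"
  by (simp add: nome_def)

lemma qpoch_eq: "qpoch k \<tau> = qp (nome \<tau> ^ k) (nome \<tau> ^ k)"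
  by (simp add: qpoch_def qp_def power_add power_mult)

lemma qpoch_deriv:
  assumes "Im \<tau> > 0" "k > 0"
  shows "(qpoch k has_field_derivative
    qpoch k \<tau> * (- (2 * of_real pi * \<i>) * of_nat k * lambert (nome \<tau> ^ k) 1)) (at \<tau>)"
proof -
  let ?G = "\<lambda>w. qp w w"
  let ?w = "nome \<tau> ^ k"
  have w: "norm ?w < 1" using norm_nome[OF assms(1)] assms(2) by (simp add: norm_power power_less_one_iff)
  have "(?G has_field_derivative deriv ?G ?w) (at ?w)"
    using w holomorphic_qp_diag by (intro holomorphic_derivI[where S = "ball 0 1"]) auto
  moreover have "((\<lambda>\<tau>. nome \<tau> ^ k) has_field_derivative 2 * of_real pi * \<i> * of_nat k * ?w) (at \<tau>)"
    unfolding nome_def exp_of_nat_mult[symmetric] by (auto intro!: derivative_eq_intros)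
  ultimately have "((\<lambda>\<tau>. ?G (nome \<tau> ^ k)) has_field_derivative
      deriv ?G ?w * (2 * of_real pi * \<i> * of_nat k * ?w)) (at \<tau>)"
    by (rule DERIV_chain2)
  moreover have "deriv ?G ?w * (2 * of_real pi * \<i> * of_nat k * ?w) =
      2 * of_real pi * \<i> * of_nat k * (?w * deriv ?G ?w)" by (simp only: mult_ac)
  ultimately show ?thesis
    by (simp add: deriv_qp_diag[OF w] qpoch_eq[abs_def] mult_ac)
qed

text \<open>Each derivative is given as value times logarithmic derivative, so the exponents in the
  quotient become coefficients of a linear combination.\<close>

lemma logderiv_quotient_power4:
  fixes a b c d :: "complex \<Rightarrow> complex"
  assumes "(a has_field_derivative a z * a') (at z)" "(b has_field_derivative b z * b') (at z)"
    "(c has_field_derivative c z * c') (at z)" "(d has_field_derivative d z * d') (at z)"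
    and "c z \<noteq> 0" "d z \<noteq> 0"
  shows "((\<lambda>z. ((a z * b z ^ 2) / (c z ^ 2 * d z)) ^ 4) has_field_derivative
    ((a z * b z ^ 2) / (c z ^ 2 * d z)) ^ 4 * (4 * (a' + 2 * b' - 2 * c' - d'))) (at z)"
proof -
  have "((\<lambda>z. (a z * b z ^ 2) / (c z ^ 2 * d z)) has_field_derivative
    ((a z * b z ^ 2) / (c z ^ 2 * d z)) * (a' + 2 * b' - 2 * c' - d')) (at z)"
    using assms by (auto intro!: derivative_eq_intros) (simp add: field_simps power2_eq_square)
  from DERIV_power[OF this, of 4] show ?thesis
    by (simp add: eval_nat_numeral mult_ac)
qed

theorem mainTheorem10:
  fixes \<tau> :: complex
  assumes "Im \<tau> > 0"
  shows "(W has_field_derivative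
           (2 * of_real pi * \<i>) *
           ((qpoch 2 \<tau> ^ 7 * qpoch 3 \<tau> ^ 7) / (qpoch 1 \<tau> ^ 5 * qpoch 6 \<tau> ^ 5)) *
           (W \<tau> - 1)) (at \<tau>)"
proof -
  define x where "x = nome \<tau>"
  have x: "x \<noteq> 0" "norm x < 1" using norm_nome[OF assms] by (auto simp: x_def nome_def)
  define A where "A = qp (x ^ 6) x * qp (x ^ 6) (x ^ 5)"
  define B where "B = qp (x ^ 6) (x ^ 2) * qp (x ^ 6) (x ^ 4)"
  define C where "C = qp (x ^ 6) (x ^ 3)"
  define D where "D = qp (x ^ 6) (x ^ 6)"
  note E = eta_quotients[OF x, folded A_def B_def C_def D_def]
  have Q: "qpoch 1 \<tau> = A * B * C * D" "qpoch 2 \<tau> = B * D" "qpoch 3 \<tau> = C * D" "qpoch 6 \<tau> = D"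
    using E(1-3) by (simp_all add: qpoch_eq D_def flip: x_def)
  define L where "L = lambert x 1 - lambert (x ^ 2) 1 - 3 * lambert (x ^ 3) 1 + 3 * lambert (x ^ 6) 1"
  \<comment> \<open>\<open>C\<close> and \<open>D\<close> cancel, leaving (1 / (A^2 B))^4.\<close>
  have "W \<tau> = 1 / (A ^ 8 * B ^ 4)"
    unfolding W_def Q using E(4-7) by (simp add: field_simps eval_nat_numeral)
  moreover have "1 / (A ^ 8 * B ^ 4) = 1 + 8 * x / (A ^ 5 * B ^ 4 * C ^ 6)"
  proof -
    have "C ^ 6 / (A ^ 8 * B ^ 4 * C ^ 6) = (A ^ 8 * B ^ 4 * C ^ 6 + 8 * x * A ^ 3) / (A ^ 8 * B ^ 4 * C ^ 6)"
      by (rule arg_cong[OF E(9)])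
    then show ?thesis using E(4-7) by (simp add: add_divide_distrib eval_nat_numeral)
  qed
  ultimately have W: "W \<tau> = 1 / (A ^ 8 * B ^ 4)" "W \<tau> - 1 = 8 * x / (A ^ 5 * B ^ 4 * C ^ 6)" by simp_all
  let ?c = "2 * of_real pi * \<i> :: complex"
  have "(W has_field_derivative W \<tau> * (4 *
      ((- ?c * of_nat 2 * lambert (nome \<tau> ^ 2) 1) + 2 * (- ?c * of_nat 3 * lambert (nome \<tau> ^ 3) 1)
       - 2 * (- ?c * of_nat 1 * lambert (nome \<tau> ^ 1) 1) - (- ?c * of_nat 6 * lambert (nome \<tau> ^ 6) 1)))) (at \<tau>)"
    unfolding W_def[abs_def]
    by (intro logderiv_quotient_power4 qpoch_deriv assms) (use Q E(4-7) in auto)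
  \<comment> \<open>The exponents 1, 2, -2, -1 times the levels 2, 3, 1, 6, the outer exponent 4 and
    the sign -1 combine to 8 \<open>L\<close>.\<close>
  then have "(W has_field_derivative ?c * (8 * L * W \<tau>)) (at \<tau>)"
    by (simp add: L_def x_def algebra_simps)
  \<comment> \<open>Both sides reduce to 8 x D^4 / (A^10 B^2 C^4).\<close>
  moreover have "8 * L * W \<tau> =
      (qpoch 2 \<tau> ^ 7 * qpoch 3 \<tau> ^ 7) / (qpoch 1 \<tau> ^ 5 * qpoch 6 \<tau> ^ 5) * (W \<tau> - 1)"
    unfolding L_def E(8) W(2) unfolding W(1) Q using E(4-7) by (simp add: field_simps eval_nat_numeral)
  ultimately show ?thesis by (simp only: mult.assoc)
qed

end
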